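(* Let $V$ be a real inner product space, let $S\subset V$ be a sphere with center $c\in V$ and radius $r>0$, let $p,q\in S$, and let $G:[a,b]\to V$ (with $a<b$) be a continuous curve. If $G$ is the minor arc from $p$ to $q$ of a great circle of $S$, then $G$ is a geodesic from $p$ to $q$; that is, $\ell(G)\le\ell(C)$ for every continuous curve $C$ from $p$ to $q$ with image contained in $S$.
   Context: The distance on $V$ is $d(x,y)=\|x-y\|$, induced by the inner product; $V$ may have any dimension (including infinite). The sphere is $S=\{x\in V: d(x,c)=r\}$. The length of a continuous curve $C:[a,b]\to V$ is $\ell(C)=\sup\sum_{i=0}^n d(C(t_i),C(t_{i+1}))\in[0,\infty]$, the supremum being over all finite partitions $a=t_0<t_1<\cdots<t_n<t_{n+1}=b$ of $[a,b]$. A great circle of $S$ is the intersection of $S$ with a two-dimensional affine plane through $c$. A curve $G:[a,b]\to V$ is (a parametrization of) the minor arc from $p$ to $q$ of a great circle if there exist a unit vector $u\in V$ orthogonal to $p-c$, a number $\omega\in[0,\pi]$, and a continuous nondecreasing surjection $\theta:[a,b]\to[0,\omega]$ such that $G(t)=c+\cos(\theta(t))\,(p-c)+r\sin(\theta(t))\,u$ for all $t\in[a,b]$ and $G(b)=q$. (If $p,q$ are distinct and not antipodal, the arc is unique as a set; if they are antipodal, any half great circle from $p$ to $q$ counts as a minor arc.) A curve from $p$ to $q$ on $S$ is a continuous curve defined on a compact interval, with initial point $p$, final point $q$ and image contained in $S$. Such a curve $G$ is called a geodesic from $p$ to $q$ when $\ell(G)\le\ell(C)$ for every continuous curve $C$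 (defined on any compact interval) from $p$ to $q$ with image contained in $S$. *)

theory Defs
  imports "HOL-Analysis.Analysis"
begin

text \<open>
  A curve is a function on \<^typ>\<open>real\<close> considered only on an interval \<open>{a..b}\<close>, its values elsewhere
  being irrelevant.  A partition is a sequence \<open>t\<close> of which only the entries \<open>0, \<dots>, n + 1\<close> matter.
  For \<open>a = b\<close> there is no partition, and the length is the supremum of the empty set in
  \<^typ>\<open>ennreal\<close>, i.e. \<open>0\<close>, as it should be for a curve defined on a single point.
\<close>

definition curve_length :: "real \<Rightarrow> real \<Rightarrow> (real \<Rightarrow> 'a::metric_space) \<Rightarrow> ennreal" where
  "curve_length a b C =
     (SUP (n, t) \<in> {(n :: nat, t :: nat \<Rightarrow> real).
                      t 0 = a \<and> t (Suc n) = b \<and> (\<forall>i\<le>n. t i < t (Suc i))}.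
        ennreal (\<Sum>i\<le>n. dist (C (t i)) (C (t (Suc i)))))"

definition curve_from_to ::
    "'a::metric_space set \<Rightarrow> 'a \<Rightarrow> 'a \<Rightarrow> real \<Rightarrow> real \<Rightarrow> (real \<Rightarrow> 'a) \<Rightarrow> bool" where
  "curve_from_to S p q a b C \<longleftrightarrow>
     a \<le> b \<and> continuous_on {a..b} C \<and> C a = p \<and> C b = q \<and> C ` {a..b} \<subseteq> S"

definition is_geodesic ::
    "'a::metric_space set \<Rightarrow> 'a \<Rightarrow> 'a \<Rightarrow> real \<Rightarrow> real \<Rightarrow> (real \<Rightarrow> 'a) \<Rightarrow> bool" where
  "is_geodesic S p q a b G \<longleftrightarrow>
     curve_from_to S p q a b G \<and>
     (\<forall>a' b' C. curve_from_to S p q a' b' C \<longrightarrow> curve_length a b G \<le> curve_length a' b' C)"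

text \<open>
  The great circle in question is the intersection of \<open>sphere c r\<close> with the plane through \<open>c\<close> spanned
  by the orthogonal vectors \<open>p - c\<close> and \<open>u\<close>.  That \<open>G a = p\<close> is implied: a nondecreasing map of
  \<open>{a..b}\<close> onto \<open>{0..\<omega>}\<close> sends \<open>a\<close> to \<open>0\<close>.  For antipodal \<open>p\<close> and \<open>q\<close>, any \<open>u\<close> is allowed.
\<close>

definition is_minor_arc ::
    "'a::real_inner \<Rightarrow> real \<Rightarrow> 'a \<Rightarrow> 'a \<Rightarrow> real \<Rightarrow> real \<Rightarrow> (real \<Rightarrow> 'a) \<Rightarrow> bool" where
  "is_minor_arc c r p q a b G \<longleftrightarrow>
     (\<exists>u \<omega> \<theta>. norm u = 1 \<and> u \<bullet> (p - c) = 0 \<and> \<omega> \<in> {0..pi} \<and>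
        continuous_on {a..b} \<theta> \<and> mono_on {a..b} \<theta> \<and> \<theta> ` {a..b} = {0..\<omega>} \<and>
        (\<forall>t\<in>{a..b}. G t = c + cos (\<theta> t) *\<^sub>R (p - c) + (r * sin (\<theta> t)) *\<^sub>R u) \<and>
        G b = q)"

end

theory Submission
  imports Defs
begin

text \<open>
  Measure distances on the sphere by the angle subtended at the centre.  Angles between vectors
  satisfy the triangle inequality (\<open>vangle_triangle\<close>, which is Cauchy--Schwarz applied to the
  components of two vectors orthogonal to the third), so the angles between consecutive points of a
  chain add up to at least the angle between its end points.  A chord of a sphere of radius \<open>r\<close>
  subtending the angle \<open>\<alpha>\<close> has length \<open>2 * r * sin (\<alpha> / 2)\<close>, which is \<open>r * \<alpha>\<close> up to a factor that
  tends to \<open>1\<close> as the chord shrinks.  By uniform continuity a curve on the sphere has inscribed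
  polygons with arbitrarily short edges, hence its length is at least \<open>r\<close> times the angle between its
  end points (\<open>vangle_le_curve_length\<close>).

  A minor arc attains this bound: its chords are at most \<open>r\<close> times the increments of the angular
  parameter \<open>\<theta>\<close>, which telescope because \<open>\<theta>\<close> is nondecreasing, so its length is at most \<open>r * \<omega>\<close>
  (\<open>curve_length_le_total_increment\<close>).  As \<open>\<omega> \<le> pi\<close>, this \<open>\<omega>\<close> is the angle between the end
  points, which is where minority of the arc enters.
\<close>

section \<open>Angles between vectors\<close>

text \<open>
  If one of the vectors is \<open>0\<close>, the value is \<open>arccos 0 = pi / 2\<close>; with this convention the triangle
  inequality holds without exception.
\<close>

definition vangle :: "'v::real_inner \<Rightarrow> 'v \<Rightarrow> real" where
  "vangle x y = arccos (sgn x \<bullet> sgn y)"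

lemma abs_inner_sgn_le_1: "\<bar>sgn x \<bullet> sgn y\<bar> \<le> 1" for x y :: "'v::real_inner"
proof -
  have "\<bar>sgn x \<bullet> sgn y\<bar> \<le> norm (sgn x) * norm (sgn y)"
    by (rule Cauchy_Schwarz_ineq2)
  also have "\<dots> \<le> 1"
    by (simp add: norm_sgn)
  finally show ?thesis .
qed

lemma cos_vangle: "cos (vangle x y) = sgn x \<bullet> sgn y"
  unfolding vangle_def using abs_inner_sgn_le_1 by (rule cos_arccos_abs)

lemma vangle_bounds: "0 \<le> vangle x y" "vangle x y \<le> pi"
  using abs_inner_sgn_le_1[of x y] by (auto simp: vangle_def arccos_lbound arccos_ubound)

text \<open>
  The left-hand side is the cosine of the sum of the two angles at \<open>y\<close>; the difference of the two
  sides is an inner product of the components of \<open>x\<close> and \<open>z\<close> orthogonal to \<open>y\<close>.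
\<close>

lemma inner_ge_cos_angle_sum:
  fixes x y z :: "'v::real_inner"
  assumes "norm x = 1" "norm y = 1" "norm z = 1"
  shows "(x \<bullet> y) * (y \<bullet> z) - sqrt (1 - (x \<bullet> y)\<^sup>2) * sqrt (1 - (y \<bullet> z)\<^sup>2) \<le> x \<bullet> z"
proof -
  have unit: "x \<bullet> x = 1" "y \<bullet> y = 1" "z \<bullet> z = 1"
    using assms by (simp_all add: dot_square_norm)
  define x' where "x' = x - (x \<bullet> y) *\<^sub>R y"
  define z' where "z' = z - (y \<bullet> z) *\<^sub>R y"
  have "norm x' = sqrt (1 - (x \<bullet> y)\<^sup>2)" "norm z' = sqrt (1 - (y \<bullet> z)\<^sup>2)"
    unfolding x'_def z'_def norm_eq_sqrt_inner
    by (simp_all add: unit inner_diff_left inner_diff_right inner_commute power2_eq_square)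
  moreover have "x' \<bullet> z' = x \<bullet> z - (x \<bullet> y) * (y \<bullet> z)"
    unfolding x'_def z'_def
    by (simp add: unit inner_diff_left inner_diff_right inner_commute algebra_simps)
  moreover have "\<bar>x' \<bullet> z'\<bar> \<le> norm x' * norm z'"
    by (rule Cauchy_Schwarz_ineq2)
  ultimately have "\<bar>x \<bullet> z - (x \<bullet> y) * (y \<bullet> z)\<bar> \<le> sqrt (1 - (x \<bullet> y)\<^sup>2) * sqrt (1 - (y \<bullet> z)\<^sup>2)"
    by simp
  then show ?thesis
    by linarith
qed

lemma vangle_triangle:
  fixes x y z :: "'v::real_inner"
  shows "vangle x z \<le> vangle x y + vangle y z"
proof (cases "x = 0 \<or> y = 0 \<or> z = 0")
  case True
  then show ?thesis
    using vangle_bounds[of x y] vangle_bounds[of y z] vangle_bounds[of x z]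
    by (auto simp: vangle_def)
next
  case False
  show ?thesis
  proof (cases "vangle x y + vangle y z \<le> pi")
    case True
    have sin_vangle: "sin (vangle v w) = sqrt (1 - (sgn v \<bullet> sgn w)\<^sup>2)" for v w :: 'v
      using abs_inner_sgn_le_1[of v w] unfolding vangle_def by (simp add: sin_arccos_abs)
    have "cos (vangle x y + vangle y z) \<le> cos (vangle x z)"
      using False inner_ge_cos_angle_sum[of "sgn x" "sgn y" "sgn z"]
      by (simp add: cos_add cos_vangle sin_vangle norm_sgn)
    then show ?thesis
      using True vangle_bounds[of x y] vangle_bounds[of y z] vangle_bounds[of x z]
      by (subst (asm) cos_mono_le_eq) auto
  next
    case False
    then show ?thesis
      using vangle_bounds(2)[of x z] by linarith
  qed
qed

lemma vangle_le_sum: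
  "vangle (f 0) (f (Suc n)) \<le> (\<Sum>i\<le>n. vangle (f i) (f (Suc i)))"
proof (induction n)
  case (Suc n)
  then show ?case
    using vangle_triangle[of "f 0" "f (Suc (Suc n))" "f (Suc n)"] by simp
qed simp

lemma vangle_same_norm:
  assumes "norm x = r" "norm y = r"
  shows "vangle x y = arccos ((x \<bullet> y) / r\<^sup>2)"
  using assms by (simp add: vangle_def sgn_div_norm divide_simps power2_eq_square)

text \<open>
  The segment from the centre to the midpoint of a chord bisects the angle and is orthogonal to the
  chord, so the sine of half the angle is half the chord over the radius.
\<close>

lemma vangle_eq_arcsin_chord:
  assumes "norm x = r" "norm y = r" "r > 0"
  shows "vangle x y = 2 * arcsin (dist x y / (2 * r))"
proof -
  define s where "s = dist x y / (2 * r)"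
  have s: "0 \<le> s" "s \<le> 1"
    using norm_triangle_ineq4[of x y] assms by (auto simp: s_def dist_norm)
  have "x \<bullet> y = r\<^sup>2 - (dist x y)\<^sup>2 / 2"
    using assms by (simp add: dot_norm_neg dist_norm diff_divide_distrib)
  then have "1 - 2 * s\<^sup>2 = (x \<bullet> y) / r\<^sup>2"
    using assms(3) by (simp add: s_def power_divide power_mult_distrib diff_divide_distrib)
  then have "cos (2 * arcsin s) = (x \<bullet> y) / r\<^sup>2"
    using s by (simp add: cos_double_sin)
  moreover have "0 \<le> arcsin s" "arcsin s \<le> pi / 2"
    using s arcsin_ubound[of s] by (auto intro: arcsin_nonneg)
  ultimately show ?thesis
    using vangle_same_norm[OF assms(1,2)] arccos_cos[of "2 * arcsin s"] by (simp add: s_def)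
qed

section \<open>Lower bound for the length of a curve on a sphere\<close>

lemma curve_length_upper:
  assumes "t 0 = a" "t (Suc n) = b" "\<And>i. i \<le> n \<Longrightarrow> t i < t (Suc i)"
  shows "ennreal (\<Sum>i\<le>n. dist (C (t i)) (C (t (Suc i)))) \<le> curve_length a b C"
  unfolding curve_length_def by (rule SUP_upper2[where i = "(n, t)"]) (use assms in auto)

lemma partition_with_short_chords:
  fixes C :: "real \<Rightarrow> 'a::metric_space"
  assumes "a < b" "continuous_on {a..b} C" "\<epsilon> > 0"
  obtains n t where "t 0 = a" "t (Suc n) = b" "\<And>i. i \<le> n \<Longrightarrow> t i < t (Suc i)"
    "\<And>i. i \<le> Suc n \<Longrightarrow> t i \<in> {a..b}"
    "\<And>i. i \<le> n \<Longrightarrow> dist (C (t i)) (C (t (Suc i))) < \<epsilon>"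
proof -
  have "uniformly_continuous_on {a..b} C"
    using assms by (intro compact_uniformly_continuous) auto
  then obtain \<delta> where \<delta>: "\<delta> > 0"
    "\<And>x y. x \<in> {a..b} \<Longrightarrow> y \<in> {a..b} \<Longrightarrow> dist y x < \<delta> \<Longrightarrow> dist (C y) (C x) < \<epsilon>"
    unfolding uniformly_continuous_on_def using \<open>\<epsilon> > 0\<close> by metis
  obtain n :: nat where n: "(b - a) / \<delta> < real n"
    using reals_Archimedean2 by blast
  define h where "h = (b - a) / real (Suc n)"
  define t where "t i = a + real i * h" for i
  have h: "h > 0"
    using assms by (simp add: h_def)
  have "(b - a) / \<delta> < real (Suc n)"
    using n by simp
  then have "h < \<delta>"
    using \<delta>(1) unfolding h_def by (simp add: field_simps)
  have t_last: "t (Suc n) = b"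
    unfolding t_def h_def by simp
  have t_in: "t i \<in> {a..b}" if "i \<le> Suc n" for i
  proof -
    have "t i \<le> t (Suc n)"
      using that h unfolding t_def by (intro add_left_mono mult_right_mono) auto
    then show ?thesis
      using h t_last by (auto simp: t_def)
  qed
  have t_step: "t (Suc i) = t i + h" for i
    by (simp add: t_def algebra_simps)
  show thesis
  proof (rule that)
    show "t 0 = a" "t (Suc n) = b"
      using t_last by (simp_all add: t_def)
    show "t i < t (Suc i)" for i
      using h t_step by simp
    show "t i \<in> {a..b}" if "i \<le> Suc n" for i
      using t_in that .
    show "dist (C (t i)) (C (t (Suc i))) < \<epsilon>" if "i \<le> n" for i
      using that h \<open>h < \<delta>\<close> by (intro \<delta>(2) t_in) (auto simp: t_step dist_real_def)
  qed
qed

text \<open>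
  Applied to half a chord of the unit circle, this says that short chords are almost as long as
  their arcs.  It holds because the derivative of \<open>arcsin\<close> at \<open>0\<close> is \<open>1\<close>.
\<close>

lemma arcsin_almost_le_near_0:
  fixes k :: real
  assumes "0 < k" "k < 1"
  obtains \<delta> where "\<delta> > 0" "\<And>s. 0 \<le> s \<Longrightarrow> s < \<delta> \<Longrightarrow> k * arcsin s \<le> s"
proof -
  have "(arcsin has_real_derivative inverse (sqrt (1 - 0\<^sup>2))) (at 0)"
    by (rule DERIV_arcsin) auto
  then have "((\<lambda>s. arcsin s / s) \<longlongrightarrow> 1) (at 0)"
    by (simp add: has_field_derivative_iff)
  then have "\<forall>\<^sub>F s in at 0. arcsin s / s < 1 / k"
    using assms by (intro order_tendstoD) auto
  then obtain \<delta> where \<delta>: "\<delta> > 0"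
    "\<And>s. s \<noteq> 0 \<Longrightarrow> dist s 0 < \<delta> \<Longrightarrow> arcsin s / s < 1 / k"
    unfolding eventually_at by blast
  show thesis
  proof (rule that)
    show "k * arcsin s \<le> s" if "0 \<le> s" "s < \<delta>" for s
    proof (cases "s = 0")
      case False
      then show ?thesis
        using \<delta>(2)[of s] that assms by (simp add: field_simps)
    qed simp
  qed (fact \<delta>(1))
qed

text \<open>
  Every \<open>k < 1\<close> gives the bound weakened by the factor \<open>k\<close>: take a partition so fine that each chord
  is at least \<open>k\<close> times its arc, and add up the angles.
\<close>

lemma vangle_le_curve_length:
  fixes c p q :: "'v::real_inner"
  assumes "r > 0" and C: "curve_from_to (sphere c r) p q a b C"
  shows "ennreal (r * vangle (p - c) (q - c)) \<le> curve_length a b C"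
proof -
  have cont: "continuous_on {a..b} C" and ends: "C a = p" "C b = q" and "a \<le> b"
    and norm_C: "\<And>x. x \<in> {a..b} \<Longrightarrow> norm (C x - c) = r"
    using C by (auto simp: curve_from_to_def dist_norm norm_minus_commute image_subset_iff)
  consider "a = b" | "a < b"
    using \<open>a \<le> b\<close> by linarith
  then show ?thesis
  proof cases
    case 1
    \<comment> \<open>A one-point interval has no partitions, but then \<open>p = q\<close> and the angle is \<open>0\<close>.\<close>
    then show ?thesis
      using norm_C[of a] ends \<open>r > 0\<close> by (simp add: vangle_eq_arcsin_chord[where r = r])
  next
    case 2
    have approx: "ennreal (k * (r * vangle (p - c) (q - c))) \<le> curve_length a b C"
      if k: "0 < k" "k < 1" for k
    proof -
      obtain \<delta> where \<delta>: "\<delta> > 0" "\<And>s. 0 \<le> s \<Longrightarrow> s < \<delta> \<Longrightarrow> k * arcsin s \<le> s"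
        using arcsin_almost_le_near_0[OF k] by blast
      have pos: "2 * r * \<delta> > 0"
        using \<delta>(1) \<open>r > 0\<close> by simp
      obtain n t where t: "t 0 = a" "t (Suc n) = b" "\<And>i. i \<le> n \<Longrightarrow> t i < t (Suc i)"
        "\<And>i. i \<le> Suc n \<Longrightarrow> t i \<in> {a..b}"
        "\<And>i. i \<le> n \<Longrightarrow> dist (C (t i)) (C (t (Suc i))) < 2 * r * \<delta>"
        by (rule partition_with_short_chords[OF 2 cont pos that])
      have chord: "k * (r * vangle (C (t i) - c) (C (t (Suc i)) - c))
          \<le> dist (C (t i)) (C (t (Suc i)))" if "i \<le> n" for i
      proof -
        define s where "s = dist (C (t i)) (C (t (Suc i))) / (2 * r)"
        have "vangle (C (t i) - c) (C (t (Suc i)) - c) = 2 * arcsin s"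
          using that t(4) norm_C \<open>r > 0\<close>
          by (subst vangle_eq_arcsin_chord[where r = r]) (auto simp: s_def dist_norm)
        moreover have "k * arcsin s \<le> s"
          using t(5)[OF that] \<open>r > 0\<close> by (intro \<delta>(2)) (auto simp: s_def field_simps)
        ultimately show ?thesis
          using \<open>r > 0\<close> by (simp add: s_def field_simps)
      qed
      have "k * (r * vangle (p - c) (q - c))
          \<le> k * (r * (\<Sum>i\<le>n. vangle (C (t i) - c) (C (t (Suc i)) - c)))"
        using vangle_le_sum[of "\<lambda>i. C (t i) - c" n] k \<open>r > 0\<close> t(1,2) ends by simp
      also have "\<dots> \<le> (\<Sum>i\<le>n. dist (C (t i)) (C (t (Suc i))))"
        unfolding sum_distrib_left by (intro sum_mono chord) auto
      finally have "ennreal (k * (r * vangle (p - c) (q - c)))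
          \<le> ennreal (\<Sum>i\<le>n. dist (C (t i)) (C (t (Suc i))))"
        by (rule ennreal_leI)
      also have "\<dots> \<le> curve_length a b C"
        using t by (intro curve_length_upper) auto
      finally show ?thesis .
    qed
    show ?thesis
    proof (cases "curve_length a b C")
      case (real l)
      have "r * vangle (p - c) (q - c) \<le> l"
      proof (rule field_le_mult_one_interval)
        show "k * (r * vangle (p - c) (q - c)) \<le> l" if "0 < k" "k < 1" for k
          using approx[OF that] real by (simp add: ennreal_le_iff)
      qed
      then show ?thesis
        using real by (simp add: ennreal_leI)
    qed simp
  qed
qed

section \<open>The length of a minor arc\<close>

text \<open>The bounds on the chords telescope along every partition.\<close>

lemma curve_length_le_total_increment:
  fixes G :: "real \<Rightarrow> 'a::metric_space" and \<phi> :: "real \<Rightarrow> real"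
  assumes "\<And>s t. a \<le> s \<Longrightarrow> s \<le> t \<Longrightarrow> t \<le> b \<Longrightarrow> dist (G s) (G t) \<le> \<phi> t - \<phi> s"
  shows "curve_length a b G \<le> ennreal (\<phi> b - \<phi> a)"
  unfolding curve_length_def
proof (rule SUP_least, clarsimp)
  fix n :: nat and t :: "nat \<Rightarrow> real"
  assume t: "a = t 0" "b = t (Suc n)" "\<forall>i\<le>n. t i < t (Suc i)"
  have mono: "t i \<le> t j" if "i \<le> j" "j \<le> Suc n" for i j
    using that
  proof (induction j rule: dec_induct)
    case (step m)
    then have "t i \<le> t m" "t m < t (Suc m)"
      using t(3) by auto
    then show ?case
      by simp
  qed simp
  have "(\<Sum>i\<le>n. dist (G (t i)) (G (t (Suc i)))) \<le> (\<Sum>i\<le>n. \<phi> (t (Suc i)) - \<phi> (t i))"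
    using t by (intro sum_mono assms) (auto intro!: mono)
  also have "\<dots> = \<phi> (t (Suc n)) - \<phi> (t 0)"
    using sum_lessThan_telescope[of "\<lambda>i. \<phi> (t i)" "Suc n"] by (simp only: lessThan_Suc_atMost)
  finally show "ennreal (\<Sum>i\<le>n. dist (G (t i)) (G (t (Suc i)))) \<le> ennreal (\<phi> (t (Suc n)) - \<phi> (t 0))"
    by (rule ennreal_leI)
qed

lemma norm_square_orthogonal_combination:
  fixes v u :: "'v::real_inner"
  assumes "norm v = r" "norm u = 1" "u \<bullet> v = 0"
  shows "(norm (x *\<^sub>R v + (r * y) *\<^sub>R u))\<^sup>2 = r\<^sup>2 * (x\<^sup>2 + y\<^sup>2)"
proof -
  have "(norm (x *\<^sub>R v + (r * y) *\<^sub>R u))\<^sup>2 = (norm (x *\<^sub>R v))\<^sup>2 + (norm ((r * y) *\<^sub>R u))\<^sup>2"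
    using assms(3) by (intro norm_add_Pythagorean) (simp add: orthogonal_def inner_commute)
  then show ?thesis
    using assms by (simp add: power_mult_distrib algebra_simps)
qed

text \<open>
  The chord is \<open>2 * r * \<bar>sin ((\<alpha> - \<beta>) / 2)\<bar>\<close>, and \<open>\<bar>sin x\<bar> \<le> \<bar>x\<bar>\<close>.
\<close>

lemma circle_chord_le:
  fixes v u :: "'v::real_inner"
  assumes "norm v = r" "norm u = 1" "u \<bullet> v = 0"
  shows "dist (c + cos \<alpha> *\<^sub>R v + (r * sin \<alpha>) *\<^sub>R u) (c + cos \<beta> *\<^sub>R v + (r * sin \<beta>) *\<^sub>R u)
    \<le> r * \<bar>\<alpha> - \<beta>\<bar>" (is "dist ?x ?y \<le> _")
proof -
  have r: "0 \<le> r"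
    using assms(1) by auto
  have diff: "?x - ?y = (cos \<alpha> - cos \<beta>) *\<^sub>R v + (r * (sin \<alpha> - sin \<beta>)) *\<^sub>R u"
    by (simp add: algebra_simps)
  have "(dist ?x ?y)\<^sup>2 = r\<^sup>2 * ((cos \<alpha> - cos \<beta>)\<^sup>2 + (sin \<alpha> - sin \<beta>)\<^sup>2)"
    unfolding dist_norm diff using assms by (rule norm_square_orthogonal_combination)
  also have "(cos \<alpha> - cos \<beta>)\<^sup>2 + (sin \<alpha> - sin \<beta>)\<^sup>2 = 2 - 2 * cos (\<alpha> - \<beta>)"
    by (simp add: cos_diff power2_diff cos_squared_eq algebra_simps)
  also have "\<dots> = (2 * sin ((\<alpha> - \<beta>) / 2))\<^sup>2"
  proof -
    have "cos (\<alpha> - \<beta>) = 1 - 2 * (sin ((\<alpha> - \<beta>) / 2))\<^sup>2"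
      using cos_double_sin[of "(\<alpha> - \<beta>) / 2"] by (simp del: right_diff_distrib_numeral)
    then show ?thesis
      by (simp add: power_mult_distrib)
  qed
  also have "\<dots> \<le> (\<alpha> - \<beta>)\<^sup>2"
    using abs_sin_x_le_abs_x[of "(\<alpha> - \<beta>) / 2"] by (subst abs_le_square_iff[symmetric]) auto
  finally have "(dist ?x ?y)\<^sup>2 \<le> (r * \<bar>\<alpha> - \<beta>\<bar>)\<^sup>2"
    by (simp add: power_mult_distrib mult_left_mono)
  then show ?thesis
    by (rule power2_le_imp_le) (simp add: r)
qed

section \<open>Minor arcs are geodesics\<close>

theorem theorem3:
  fixes c p q :: "'v::real_inner" and r a b :: real and G :: "real \<Rightarrow> 'v"
  assumes "r > 0"
    and "p \<in> sphere c r" and "q \<in> sphere c r"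
    and "a < b" and "continuous_on {a..b} G"
    and "is_minor_arc c r p q a b G"
  shows "is_geodesic (sphere c r) p q a b G"
proof -
  obtain u \<omega> \<theta> where u: "norm u = 1" "u \<bullet> (p - c) = 0" and \<omega>: "0 \<le> \<omega>" "\<omega> \<le> pi"
    and mono: "mono_on {a..b} \<theta>" and onto: "\<theta> ` {a..b} = {0..\<omega>}"
    and G: "\<And>t. t \<in> {a..b} \<Longrightarrow> G t = c + cos (\<theta> t) *\<^sub>R (p - c) + (r * sin (\<theta> t)) *\<^sub>R u"
    and Gb: "G b = q"
    using assms(6) unfolding is_minor_arc_def by auto
  have norm_p: "norm (p - c) = r" and norm_q: "norm (q - c) = r"
    using assms(2,3) by (auto simp: dist_norm norm_minus_commute)
  have \<theta>a: "\<theta> a = 0" and \<theta>b: "\<theta> b = \<omega>"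
  proof -
    obtain s s' where s: "s \<in> {a..b}" "\<theta> s = 0" "s' \<in> {a..b}" "\<theta> s' = \<omega>"
      using onto \<omega> by (metis atLeastAtMost_iff imageE order_refl)
    have "\<theta> a \<in> {0..\<omega>}" "\<theta> b \<in> {0..\<omega>}"
      using onto \<open>a < b\<close> by (metis atLeastAtMost_iff imageI less_imp_le order_refl)+
    moreover have "\<theta> a \<le> \<theta> s" "\<theta> s' \<le> \<theta> b"
      using s(1,3) \<open>a < b\<close> by (auto intro!: mono_onD[OF mono])
    ultimately show "\<theta> a = 0" "\<theta> b = \<omega>"
      using s by auto
  qed
  have "G a = p"
    using G[of a] \<open>a < b\<close> \<theta>a by simp
  have on_sphere: "G t \<in> sphere c r" if "t \<in> {a..b}" for t
  proof -
    have "G t - c = cos (\<theta> t) *\<^sub>R (p - c) + (r * sin (\<theta> t)) *\<^sub>R u"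
      by (simp add: G[OF that])
    then have "(norm (G t - c))\<^sup>2 = r\<^sup>2"
      by (simp add: norm_square_orthogonal_combination[OF norm_p u])
    then show ?thesis
      using \<open>r > 0\<close> by (simp add: dist_norm norm_minus_commute)
  qed
  have "curve_from_to (sphere c r) p q a b G"
    using assms(4,5) \<open>G a = p\<close> Gb on_sphere by (auto simp: curve_from_to_def)
  moreover have "curve_length a b G \<le> ennreal (r * vangle (p - c) (q - c))"
  proof -
    \<comment> \<open>\<open>arccos\<close> recovers \<open>\<omega>\<close> from its cosine because \<open>\<omega> \<in> {0..pi}\<close>.\<close>
    have "(p - c) \<bullet> (q - c) = r\<^sup>2 * cos \<omega>"
      using G[of b] \<open>a < b\<close> Gb \<theta>b u norm_p
      by (auto simp: inner_add_right dot_square_norm inner_commute)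
    then have "vangle (p - c) (q - c) = \<omega>"
      using vangle_same_norm[OF norm_p norm_q] \<open>r > 0\<close> \<omega> by (simp add: arccos_cos)
    moreover have "curve_length a b G \<le> ennreal (r * \<theta> b - r * \<theta> a)"
    proof (rule curve_length_le_total_increment)
      fix s t
      assume st: "a \<le> s" "s \<le> t" "t \<le> b"
      then have "\<theta> s \<le> \<theta> t"
        by (intro mono_onD[OF mono]) auto
      then show "dist (G s) (G t) \<le> r * \<theta> t - r * \<theta> s"
        using circle_chord_le[OF norm_p u, of c "\<theta> s" "\<theta> t"] st
        by (simp add: G algebra_simps)
    qed
    ultimately show ?thesis
      by (simp add: \<theta>a \<theta>b)
  qed
  ultimately show ?thesis
    unfolding is_geodesic_def using vangle_le_curve_length[OF \<open>r > 0\<close>] order_trans by blast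
qed

end
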